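(* Let $(\alpha^1,\alpha^2,\alpha^3)$ be the (right-invariant) Maurer–Cartan forms of $SU(2)$. Then the coframing $$\omega^1=\alpha^1,\qquad \omega^2=df-\alpha^3,\qquad \omega^3=\alpha^2$$ is an $(I,J,1)$-generalized Finsler structure which descends to $SU(2)/\mathcal{D}_8^*$, with the invariants $I=f_{\alpha 1}$, $J=f_{\alpha 2}$, where $f:SU(2)\to\mathbb{R}$ is a smooth function such that $$f(a_1,b_0,b_1)=\Phi\Bigl(\arctan\frac{a_0b_0+a_1b_1}{a_0b_1-a_1b_0}\Bigr),$$ with $\Phi$ an arbitrary even function of one variable.
   Context: $SU(2)$ is identified with the unit quaternions $g=a_0+ia_1+jb_0+kb_1$, $a_0^2+a_1^2+b_0^2+b_1^2=1$; $(a_1,b_0,b_1)$ are used as local coordinates, with $a_0=\sqrt{1-a_1^2-b_0^2-b_1^2}$. The Maurer–Cartan forms (from $dg\cdot g^{-1}$) are the restrictions to $\mathbb{S}^3$ of $$\alpha^1=2(-b_0da_0+b_1da_1+a_0db_0-a_1db_1),\quad \alpha^2=2(-b_1da_0-b_0da_1+a_1db_0+a_0db_1),\quad \alpha^3=2(-a_1da_0+a_0da_1-b_1db_0+b_0db_1),$$ which satisfy $d\alpha^1=\alpha^2\wedge\alpha^3$, $d\alpha^2=\alpha^3\wedge\alpha^1$, $d\alpha^3=\alpha^1\wedge\alpha^2$. Directional derivatives are defined by $df=f_{\alpha 1}\alpha^1+f_{\alpha 2}\alpha^2+f_{\alpha 3}\alpha^3$. $\mathcal{D}_8^*=\{\pm1,\pm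 i,\pm j,\pm k\}\subset SU(2)$ is the binary dihedral group of order 8 (the quaternion group); it acts on $SU(2)$ by $g\mapsto g\cdot x$, and "descends" means the coframing is invariant under this action. An $(I,J,1)$-generalized Finsler structure is a coframe $(\omega^1,\omega^2,\omega^3)$ with $$d\omega^1=-I\,\omega^1\wedge\omega^3+\omega^2\wedge\omega^3,\quad d\omega^2=-\omega^1\wedge\omega^3,\quad d\omega^3=\omega^1\wedge\omega^2-J\,\omega^1\wedge\omega^3.$$ *)

theory Defs
  imports "HOL-Analysis.Analysis"
begin

text \<open>
  The tuple \<open>(a0, a1, b0, b1)\<close> is the quaternion \<open>a0 + i a1 + j b0 + k b1\<close>.  The group \<open>SU(2)\<close> is
  the unit sphere in this four-dimensional Euclidean space, and tangent vectors of \<open>SU(2)\<close> are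
  vectors of the ambient space.
\<close>

type_synonym quat = "real \<times> real \<times> real \<times> real"

fun qmult :: "quat \<Rightarrow> quat \<Rightarrow> quat" where
  "qmult (a0, a1, b0, b1) (c0, c1, d0, d1) =
     (a0 * c0 - a1 * c1 - b0 * d0 - b1 * d1,
      a0 * c1 + a1 * c0 + b0 * d1 - b1 * d0,
      a0 * d0 - a1 * d1 + b0 * c0 + b1 * c1,
      a0 * d1 + a1 * d0 - b0 * c1 + b1 * c0)"

fun qconj :: "quat \<Rightarrow> quat" where
  "qconj (a0, a1, b0, b1) = (a0, - a1, - b0, - b1)"

definition SU2 :: "quat set" where
  "SU2 = {(a0, a1, b0, b1). a0\<^sup>2 + a1\<^sup>2 + b0\<^sup>2 + b1\<^sup>2 = 1}"

definition D8 :: "quat set" where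
  "D8 = {(1, 0, 0, 0), (-1, 0, 0, 0), (0, 1, 0, 0), (0, -1, 0, 0),
         (0, 0, 1, 0), (0, 0, -1, 0), (0, 0, 0, 1), (0, 0, 0, -1)}"

definition tangent :: "quat \<Rightarrow> quat set" where
  "tangent p = {v. inner v p = 0}"

definition proj :: "quat \<Rightarrow> quat \<Rightarrow> quat" where
  "proj p v = v - inner v p *\<^sub>R p"

definition D8_invariant :: "quat set \<Rightarrow> bool" where
  "D8_invariant U \<longleftrightarrow> (\<forall>g\<in>U. \<forall>x\<in>D8. qmult g x \<in> U)"


subsection \<open>Smooth functions\<close>

fun Ck_on :: "nat \<Rightarrow> quat set \<Rightarrow> (quat \<Rightarrow> real) \<Rightarrow> bool" where
  "Ck_on 0 V F \<longleftrightarrow> continuous_on V F"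
| "Ck_on (Suc k) V F \<longleftrightarrow>
     (\<forall>p\<in>V. F differentiable (at p)) \<and> (\<forall>w. Ck_on k V (\<lambda>p. frechet_derivative F (at p) w))"

definition ambient_smooth_on :: "quat set \<Rightarrow> (quat \<Rightarrow> real) \<Rightarrow> bool" where
  "ambient_smooth_on V F \<longleftrightarrow> open V \<and> (\<forall>k. Ck_on k V F)"

definition smooth_function_on :: "quat set \<Rightarrow> (quat \<Rightarrow> real) \<Rightarrow> bool" where
  "smooth_function_on U f \<longleftrightarrow>
     (\<forall>p\<in>U. \<exists>V F. p \<in> V \<and> ambient_smooth_on V F \<and> (\<forall>q\<in>V \<inter> U. F q = f q))"


subsection \<open>Differential forms on open subsets of the group\<close>

text \<open>
  A one-form assigns to a point \<open>p\<close> of \<open>SU(2)\<close> a functional on ambient vectors, of which only the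
  values on \<open>tangent p\<close> matter; a two-form is treated likewise.  Derivatives are taken
  \<open>at p within SU2\<close>: such a derivative is determined only on tangent vectors (see
  \<open>derivative_within_SU2_unique\<close> below), and it is only ever evaluated there.
\<close>

type_synonym one_form = "quat \<Rightarrow> quat \<Rightarrow> real"
type_synonym two_form = "quat \<Rightarrow> quat \<Rightarrow> quat \<Rightarrow> real"

lemma derivative_within_SU2_unique:
  fixes f :: "quat \<Rightarrow> real"
  assumes "(f has_derivative D) (at p within SU2)" "(f has_derivative E) (at p within SU2)"
    and "p \<in> SU2" "v \<in> tangent p"
  shows "D v = E v"
proof (cases "v = 0")
  case True
  then show ?thesis
    using assms(1,2) has_derivative_linear linear_0 by metis
next
  case False
  define r where "r = norm v"
  have r: "r > 0" using False by (simp add: r_def)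
  define c where "c t = cos (r * t) *\<^sub>R p + (sin (r * t) / r) *\<^sub>R v" for t
  have SU2_iff: "q \<in> SU2 \<longleftrightarrow> inner q q = 1" for q
    by (cases q) (simp add: SU2_def inner_prod_def power2_eq_square algebra_simps)
  have vp: "inner v p = 0" "inner p v = 0" using assms(4) by (simp_all add: tangent_def inner_commute)
  have pp: "inner p p = 1" using assms(3) SU2_iff by simp
  have vv: "inner v v = r * r" by (simp add: r_def dot_square_norm power2_eq_square)
  have c_in: "c t \<in> SU2" for t
  proof -
    have "inner (c t) (c t) = (cos (r * t))\<^sup>2 + (sin (r * t))\<^sup>2"
      using r by (simp add: c_def inner_add_left inner_add_right vp pp vv power2_eq_square)
    then show ?thesis by (simp add: SU2_iff)
  qed
  have c0: "c 0 = p" by (simp add: c_def)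
  have dc: "(c has_derivative (\<lambda>t. t *\<^sub>R v)) (at 0)"
    unfolding c_def using r by (auto intro!: derivative_eq_intros)
  have dfc: "((\<lambda>t. f (c t)) has_derivative (\<lambda>t. G (t *\<^sub>R v))) (at 0)"
    if "(f has_derivative G) (at p within SU2)" for G
    using that c_in c0
    by (intro has_derivative_in_compose[OF dc]) (auto intro: has_derivative_subset)
  show ?thesis
    using has_derivative_unique[OF dfc[OF assms(1)] dfc[OF assms(2)]] by (metis scaleR_one)
qed

definition differential :: "(quat \<Rightarrow> real) \<Rightarrow> one_form" where
  "differential f p v = frechet_derivative f (at p within SU2) v"

definition wedge :: "one_form \<Rightarrow> one_form \<Rightarrow> two_form" where
  "wedge \<omega> \<eta> p v w = \<omega> p v * \<eta> p w - \<omega> p w * \<eta> p v"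

text \<open>
  The exterior derivative is \<open>d\<omega>(v, w) = D\<^sub>v (\<omega> w) - D\<^sub>w (\<omega> v)\<close> for constant ambient \<open>v\<close> and \<open>w\<close>.
  These are tangent at \<open>p\<close> but not at nearby points, so \<open>\<omega>\<close> is first extended by zero in the
  normal direction.  Every other extension gives the same values on tangent vectors at \<open>p\<close>, since
  the form \<open>inner _ q\<close> has zero exterior derivative and vanishes on tangent vectors.
\<close>

definition ext_deriv :: "one_form \<Rightarrow> two_form" where
  "ext_deriv \<omega> p v w =
     frechet_derivative (\<lambda>q. \<omega> q (proj q w)) (at p within SU2) v -
     frechet_derivative (\<lambda>q. \<omega> q (proj q v)) (at p within SU2) w"

definition smooth_one_form_on :: "quat set \<Rightarrow> one_form \<Rightarrow> bool" where
  "smooth_one_form_on U \<omega> \<longleftrightarrow>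
     (\<forall>p\<in>U. \<exists>V \<beta>. p \<in> V \<and> (\<forall>q\<in>V. linear (\<beta> q)) \<and> (\<forall>w. ambient_smooth_on V (\<lambda>q. \<beta> q w)) \<and>
        (\<forall>q\<in>V \<inter> U. \<forall>v\<in>tangent q. \<beta> q v = \<omega> q v))"

definition pullback :: "(quat \<Rightarrow> quat) \<Rightarrow> one_form \<Rightarrow> one_form" where
  "pullback \<phi> \<omega> p v = \<omega> (\<phi> p) (frechet_derivative \<phi> (at p) v)"

definition coframe_on :: "quat set \<Rightarrow> one_form \<Rightarrow> one_form \<Rightarrow> one_form \<Rightarrow> bool" where
  "coframe_on U \<omega>1 \<omega>2 \<omega>3 \<longleftrightarrow>
     smooth_one_form_on U \<omega>1 \<and> smooth_one_form_on U \<omega>2 \<and> smooth_one_form_on U \<omega>3 \<and>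
     (\<forall>p\<in>U. \<forall>c1 c2 c3.
        (\<forall>v\<in>tangent p. c1 * \<omega>1 p v + c2 * \<omega>2 p v + c3 * \<omega>3 p v = 0) \<longrightarrow> c1 = 0 \<and> c2 = 0 \<and> c3 = 0)"

definition descends_D8 :: "quat set \<Rightarrow> one_form \<Rightarrow> bool" where
  "descends_D8 U \<omega> \<longleftrightarrow>
     D8_invariant U \<and>
     (\<forall>x\<in>D8. \<forall>p\<in>U. \<forall>v\<in>tangent p. pullback (\<lambda>g. qmult g x) \<omega> p v = \<omega> p v)"

definition IJ1_generalized_Finsler ::
    "quat set \<Rightarrow> (quat \<Rightarrow> real) \<Rightarrow> (quat \<Rightarrow> real) \<Rightarrow> one_form \<Rightarrow> one_form \<Rightarrow> one_form \<Rightarrow> bool" where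
  "IJ1_generalized_Finsler U I J \<omega>1 \<omega>2 \<omega>3 \<longleftrightarrow>
     coframe_on U \<omega>1 \<omega>2 \<omega>3 \<and>
     (\<forall>p\<in>U. \<forall>v\<in>tangent p. \<forall>w\<in>tangent p.
        ext_deriv \<omega>1 p v w = - I p * wedge \<omega>1 \<omega>3 p v w + wedge \<omega>2 \<omega>3 p v w \<and>
        ext_deriv \<omega>2 p v w = - wedge \<omega>1 \<omega>3 p v w \<and>
        ext_deriv \<omega>3 p v w = wedge \<omega>1 \<omega>2 p v w - J p * wedge \<omega>1 \<omega>3 p v w)"


subsection \<open>The Maurer-Cartan coframe\<close>

fun \<alpha>1 :: one_form where
  "\<alpha>1 (a0, a1, b0, b1) (da0, da1, db0, db1) = 2 * (- b0 * da0 + b1 * da1 + a0 * db0 - a1 * db1)"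

fun \<alpha>2 :: one_form where
  "\<alpha>2 (a0, a1, b0, b1) (da0, da1, db0, db1) = 2 * (- b1 * da0 - b0 * da1 + a1 * db0 + a0 * db1)"

fun \<alpha>3 :: one_form where
  "\<alpha>3 (a0, a1, b0, b1) (da0, da1, db0, db1) = 2 * (- a1 * da0 + a0 * da1 - b1 * db0 + b0 * db1)"

text \<open>
  On the unit sphere \<open>qconj g\<close> is the inverse of \<open>g\<close>, so these are the components of
  \<open>dg \<cdot> g\<^sup>-\<^sup>1\<close> in the basis \<open>j/2, k/2, i/2\<close> of the Lie algebra.
\<close>

lemma alpha_Maurer_Cartan:
  assumes "g \<in> SU2" "v \<in> tangent g"
  shows "qmult v (qconj g) = (0, \<alpha>3 g v / 2, \<alpha>1 g v / 2, \<alpha>2 g v / 2)"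
  using assms by (cases g; cases v) (simp add: tangent_def inner_prod_def algebra_simps)

lemma qmult_inverse:
  assumes "g \<in> SU2"
  shows "qmult g (qconj g) = (1, 0, 0, 0)"
  using assms by (cases g) (simp add: SU2_def power2_eq_square algebra_simps)

lemma ext_deriv_bilinear:
  assumes "p \<in> SU2" "v \<in> tangent p" "w \<in> tangent p"
    and "\<And>q u. \<omega> q (proj q u) = \<omega> q u" "\<And>u. linear (\<lambda>q. \<omega> q u)"
  shows "ext_deriv \<omega> p v w = \<omega> v w - \<omega> w v"
proof -
  have d: "((\<lambda>q. \<omega> q u) has_derivative (\<lambda>q. \<omega> q u)) (at p within SU2)" for u
    by (intro bounded_linear_imp_has_derivative linear_conv_bounded_linear[THEN iffD1] assms)
  have "((\<lambda>q. \<omega> q u) has_derivative frechet_derivative (\<lambda>q. \<omega> q u) (at p within SU2))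
      (at p within SU2)" for u
    using d[of u] by (metis differentiableI frechet_derivative_works)
  then have "frechet_derivative (\<lambda>q. \<omega> q u) (at p within SU2) z = \<omega> z u" if "z \<in> tangent p" for u z
    using derivative_within_SU2_unique[OF _ d assms(1) that] by blast
  then show ?thesis using assms(2-4) by (simp add: ext_deriv_def)
qed

lemma alpha_proj: "\<alpha>1 q (proj q u) = \<alpha>1 q u" "\<alpha>2 q (proj q u) = \<alpha>2 q u" "\<alpha>3 q (proj q u) = \<alpha>3 q u"
  by (cases q; cases u; simp add: proj_def inner_prod_def algebra_simps)+

lemma alpha_linear: "linear (\<lambda>q. \<alpha>1 q u)" "linear (\<lambda>q. \<alpha>2 q u)" "linear (\<lambda>q. \<alpha>3 q u)"
  by (cases u; auto intro!: linearI simp: algebra_simps)+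

lemma tangent_frame:
  assumes "(a0, a1, b0, b1) \<in> SU2" "v \<in> tangent (a0, a1, b0, b1)"
  obtains x y z where
    "v = (- b0 * x - b1 * y - a1 * z, b1 * x - b0 * y + a0 * z,
          a0 * x + a1 * y - b1 * z, - a1 * x + a0 * y + b0 * z)"
    "\<alpha>1 (a0, a1, b0, b1) v = 2 * x"
    "\<alpha>2 (a0, a1, b0, b1) v = 2 * y"
    "\<alpha>3 (a0, a1, b0, b1) v = 2 * z"
proof -
  obtain v0 v1 v2 v3 where v: "v = (v0, v1, v2, v3)" by (cases v)
  define x where "x = - b0 * v0 + b1 * v1 + a0 * v2 - a1 * v3"
  define y where "y = - b1 * v0 - b0 * v1 + a1 * v2 + a0 * v3"
  define z where "z = - a1 * v0 + a0 * v1 - b1 * v2 + b0 * v3"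
  define N where "N = a0 * a0 + a1 * a1 + b0 * b0 + b1 * b1"
  define T where "T = v0 * a0 + v1 * a1 + v2 * b0 + v3 * b1"
  have N: "N = 1" using assms(1) by (simp add: N_def SU2_def power2_eq_square)
  have T: "T = 0" using assms(2) by (simp add: T_def v tangent_def inner_prod_def)
  have "v0 * N = - b0 * x - b1 * y - a1 * z + T * a0"
    and "v1 * N = b1 * x - b0 * y + a0 * z + T * a1"
    and "v2 * N = a0 * x + a1 * y - b1 * z + T * b0"
    and "v3 * N = - a1 * x + a0 * y + b0 * z + T * b1"
    by (simp_all add: N_def T_def x_def y_def z_def algebra_simps)
  then have *: "v = (- b0 * x - b1 * y - a1 * z, b1 * x - b0 * y + a0 * z,
      a0 * x + a1 * y - b1 * z, - a1 * x + a0 * y + b0 * z)"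
    by (simp add: v N T)
  show thesis
    by (rule that[OF *]) (simp_all add: v x_def y_def z_def)
qed

lemma alpha_structure_equations:
  assumes "p \<in> SU2" "v \<in> tangent p" "w \<in> tangent p"
  shows "ext_deriv \<alpha>1 p v w = wedge \<alpha>2 \<alpha>3 p v w"
    and "ext_deriv \<alpha>2 p v w = wedge \<alpha>3 \<alpha>1 p v w"
    and "ext_deriv \<alpha>3 p v w = wedge \<alpha>1 \<alpha>2 p v w"
proof -
  obtain a0 a1 b0 b1 where p: "p = (a0, a1, b0, b1)" by (cases p)
  obtain x y z where v: "v = (- b0 * x - b1 * y - a1 * z, b1 * x - b0 * y + a0 * z,
      a0 * x + a1 * y - b1 * z, - a1 * x + a0 * y + b0 * z)"
    and \<alpha>v: "\<alpha>1 p v = 2 * x" "\<alpha>2 p v = 2 * y" "\<alpha>3 p v = 2 * z"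
    using tangent_frame assms(1,2) unfolding p by metis
  obtain x' y' z' where w: "w = (- b0 * x' - b1 * y' - a1 * z', b1 * x' - b0 * y' + a0 * z',
      a0 * x' + a1 * y' - b1 * z', - a1 * x' + a0 * y' + b0 * z')"
    and \<alpha>w: "\<alpha>1 p w = 2 * x'" "\<alpha>2 p w = 2 * y'" "\<alpha>3 p w = 2 * z'"
    using tangent_frame assms(1,3) unfolding p by metis
  define N where "N = a0 * a0 + a1 * a1 + b0 * b0 + b1 * b1"
  have N: "N = 1" using assms(1) by (simp add: p N_def SU2_def power2_eq_square)
  have "\<alpha>1 v w - \<alpha>1 w v = 4 * (y * z' - y' * z) * N"
    "\<alpha>2 v w - \<alpha>2 w v = 4 * (z * x' - z' * x) * N"
    "\<alpha>3 v w - \<alpha>3 w v = 4 * (x * y' - x' * y) * N"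
    by (simp_all add: v w N_def algebra_simps)
  then show "ext_deriv \<alpha>1 p v w = wedge \<alpha>2 \<alpha>3 p v w"
    "ext_deriv \<alpha>2 p v w = wedge \<alpha>3 \<alpha>1 p v w"
    "ext_deriv \<alpha>3 p v w = wedge \<alpha>1 \<alpha>2 p v w"
    by (simp_all add: ext_deriv_bilinear[OF assms] alpha_proj alpha_linear wedge_def \<alpha>v \<alpha>w N
        algebra_simps)
qed

text \<open>The triple of functions with \<open>df = f\<^sub>\<alpha>\<^sub>1 \<alpha>\<^sup>1 + f\<^sub>\<alpha>\<^sub>2 \<alpha>\<^sup>2 + f\<^sub>\<alpha>\<^sub>3 \<alpha>\<^sup>3\<close> on tangent vectors.\<close>

definition directional_derivs :: "(quat \<Rightarrow> real) \<Rightarrow> quat \<Rightarrow> real \<times> real \<times> real" where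
  "directional_derivs f p =
     (THE c. \<forall>v\<in>tangent p.
        differential f p v = fst c * \<alpha>1 p v + fst (snd c) * \<alpha>2 p v + snd (snd c) * \<alpha>3 p v)"

definition d_\<alpha>1 :: "(quat \<Rightarrow> real) \<Rightarrow> quat \<Rightarrow> real" where
  "d_\<alpha>1 f p = fst (directional_derivs f p)"

definition d_\<alpha>2 :: "(quat \<Rightarrow> real) \<Rightarrow> quat \<Rightarrow> real" where
  "d_\<alpha>2 f p = fst (snd (directional_derivs f p))"


subsection \<open>Functions of the given shape\<close>

text \<open>
  The formula is required wherever its denominator does not vanish, on both hemispheres
  \<open>a0 > 0\<close> and \<open>a0 < 0\<close>.  At other points of the domain the value of a smooth \<open>f\<close> is determined by
  continuity; HOL's \<open>x / 0 = 0\<close> plays no role.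
\<close>

definition has_arctan_form :: "quat set \<Rightarrow> (real \<Rightarrow> real) \<Rightarrow> (quat \<Rightarrow> real) \<Rightarrow> bool" where
  "has_arctan_form U \<Phi> f \<longleftrightarrow>
     (\<forall>a0 a1 b0 b1. (a0, a1, b0, b1) \<in> U \<longrightarrow> a0 * b1 - a1 * b0 \<noteq> 0 \<longrightarrow>
        f (a0, a1, b0, b1) = \<Phi> (arctan ((a0 * b0 + a1 * b1) / (a0 * b1 - a1 * b0))))"

text \<open>
  The quotient of \<open>a0 b0 + a1 b1\<close> by \<open>a0 b1 - a1 b0\<close> takes all real values near a point where both
  vanish, so a function of this shape that is smooth on all of \<open>SU2\<close> is constant.  The forms are
  therefore considered over an arbitrary open \<open>D8\<close>-invariant domain in \<open>SU2\<close>.  The two lemmas below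
  say that \<open>SU2\<close> itself and the set where the quotient is defined are such domains.
\<close>

definition D8_domain :: "quat set \<Rightarrow> bool" where
  "D8_domain U \<longleftrightarrow> openin (top_of_set SU2) U \<and> D8_invariant U"

lemma D8_domain_SU2: "D8_domain SU2"
  by (auto simp: D8_domain_def D8_invariant_def D8_def SU2_def power2_eq_square)

lemma D8_domain_quotient_defined:
  "D8_domain {(a0, a1, b0, b1). (a0, a1, b0, b1) \<in> SU2 \<and> a0 * b1 - a1 * b0 \<noteq> 0}"
proof -
  define h :: "quat \<Rightarrow> real"
    where "h g = fst g * snd (snd (snd g)) - fst (snd g) * fst (snd (snd g))" for g
  have eq: "{(a0, a1, b0, b1). (a0, a1, b0, b1) \<in> SU2 \<and> a0 * b1 - a1 * b0 \<noteq> 0} = SU2 \<inter> {g. h g \<noteq> 0}"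
    by (auto simp: h_def)
  have "open {g. h g \<noteq> 0}"
    unfolding h_def by (intro open_Collect_neq continuous_intros)
  then have "openin (top_of_set SU2) (SU2 \<inter> {g. h g \<noteq> 0})"
    by (rule openin_open_Int)
  moreover have "h (qmult g x) = h g \<or> h (qmult g x) = - h g" if "x \<in> D8" for g x
    using that by (cases g) (auto simp: D8_def h_def)
  then have "h (qmult g x) \<noteq> 0" if "x \<in> D8" "h g \<noteq> 0" for g x
    using that by (metis neg_equal_0_iff_equal)
  then have "D8_invariant (SU2 \<inter> {g. h g \<noteq> 0})"
    using D8_domain_SU2 by (simp add: D8_domain_def D8_invariant_def)
  ultimately show ?thesis unfolding eq D8_domain_def by blast
qed

end

theory Submission
  imports Defs
begin

text \<open>
  Substituting \<open>\<omega>2 = df - \<alpha>3\<close> into the structure equations and using \<open>d (df) = 0\<close>, one finds that they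
  hold with \<open>I = f\<^sub>\<alpha>\<^sub>1\<close> and \<open>J = f\<^sub>\<alpha>\<^sub>2\<close> if and only if \<open>f\<^sub>\<alpha>\<^sub>3 = 0\<close>.  The vector field dual to \<open>\<alpha>3\<close>
  generates the left multiplications by \<open>cos t + i sin t\<close>, which preserve the quotient inside the
  arctangent, so \<open>f\<^sub>\<alpha>\<^sub>3\<close> vanishes where its denominator does not, and by density everywhere.
  Right multiplication by an element of \<open>D8\<close> changes the quotient at most by a sign, which the even
  function \<open>\<Phi>\<close> does not see; since the \<open>\<alpha>\<close>'s are right-invariant, the coframing descends.
\<close>

subsection \<open>Symmetry of second derivatives\<close>

text \<open>Two applications of the mean value theorem: first in the direction \<open>v\<close>, to
  the function \<open>\<phi>\<close> whose increment over [0, h] is the second difference, then in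
  the direction \<open>w\<close>, to \<open>F' _ v\<close>. The left-hand side is symmetric in
  \<open>v\<close> and \<open>w\<close>, which is what makes mixed derivatives comparable.\<close>

lemma second_difference_MVT:
  fixes F :: "'a::real_normed_vector \<Rightarrow> real"
  assumes "h > 0"
    and in_V: "\<And>s t. 0 \<le> s \<Longrightarrow> s \<le> h \<Longrightarrow> 0 \<le> t \<Longrightarrow> t \<le> h \<Longrightarrow> p + s *\<^sub>R v + t *\<^sub>R w \<in> V"
    and F': "\<And>q. q \<in> V \<Longrightarrow> (F has_derivative F' q) (at q)"
    and F'': "\<And>q. q \<in> V \<Longrightarrow> ((\<lambda>q. F' q v) has_derivative A q) (at q)"
  obtains s t where "0 < s" "s < h" "0 < t" "t < h"
    "F (p + h *\<^sub>R v + h *\<^sub>R w) - F (p + h *\<^sub>R v) - F (p + h *\<^sub>R w) + F p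
       = h * h * A (p + s *\<^sub>R v + t *\<^sub>R w) w"
proof -
  have line: "((\<lambda>s. G (a + s *\<^sub>R u)) has_real_derivative G' u) (at s)"
    if "(G has_derivative G') (at (a + s *\<^sub>R u))" for G :: "'a \<Rightarrow> real" and G' a u s
  proof -
    have "((\<lambda>s. a + s *\<^sub>R u) has_derivative (\<lambda>x. x *\<^sub>R u)) (at s)"
      by (auto intro!: derivative_eq_intros)
    then have "((\<lambda>s. G (a + s *\<^sub>R u)) has_derivative (\<lambda>x. G' (x *\<^sub>R u))) (at s)"
      using that by (rule has_derivative_compose)
    moreover have "(\<lambda>x. G' (x *\<^sub>R u)) = (*) (G' u)"
      using has_derivative_linear[OF that] by (auto simp: linear_cmul)
    ultimately show ?thesis by (simp add: has_field_derivative_def)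
  qed
  define \<phi> where "\<phi> s = F ((p + h *\<^sub>R w) + s *\<^sub>R v) - F (p + s *\<^sub>R v)" for s
  have mem: "p + h *\<^sub>R w + s *\<^sub>R v \<in> V" "p + s *\<^sub>R v \<in> V" if "0 \<le> s" "s \<le> h" for s
    using in_V[OF that, of h] in_V[OF that, of 0] \<open>h > 0\<close> by (simp_all add: ac_simps)
  have "\<exists>s. 0 < s \<and> s < h \<and>
      \<phi> h - \<phi> 0 = (h - 0) * (F' ((p + h *\<^sub>R w) + s *\<^sub>R v) v - F' (p + s *\<^sub>R v) v)"
    unfolding \<phi>_def using \<open>h > 0\<close> mem by (intro MVT2 DERIV_diff line F') auto
  then obtain s where s: "0 < s" "s < h"
    and \<phi>: "\<phi> h - \<phi> 0 = h * (F' ((p + h *\<^sub>R w) + s *\<^sub>R v) v - F' (p + s *\<^sub>R v) v)"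
    by auto
  have "\<exists>t. 0 < t \<and> t < h \<and>
      F' ((p + s *\<^sub>R v) + h *\<^sub>R w) v - F' ((p + s *\<^sub>R v) + 0 *\<^sub>R w) v
        = (h - 0) * A ((p + s *\<^sub>R v) + t *\<^sub>R w) w"
    using \<open>h > 0\<close> s in_V by (intro MVT2 line F'') auto
  then obtain t where t: "0 < t" "t < h"
    and "F' (p + s *\<^sub>R v + h *\<^sub>R w) v - F' (p + s *\<^sub>R v) v = h * A (p + s *\<^sub>R v + t *\<^sub>R w) w"
    by auto
  then have "F (p + h *\<^sub>R v + h *\<^sub>R w) - F (p + h *\<^sub>R v) - F (p + h *\<^sub>R w) + F p
       = h * h * A (p + s *\<^sub>R v + t *\<^sub>R w) w"
    using \<phi> by (simp add: \<phi>_def ac_simps)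
  with s t show thesis by (rule that)
qed

text \<open>Exchanging \<open>v\<close> and \<open>w\<close> does not change the second difference,
  so a value of \<open>A _ w\<close> near \<open>p\<close> equals a value of \<open>B _ v\<close>
  near \<open>p\<close>. Continuity of both at \<open>p\<close> then forces the limits to
  agree.\<close>

lemma second_derivative_symmetric:
  fixes F :: "'a::real_normed_vector \<Rightarrow> real"
  assumes "open V" "p \<in> V"
    and F': "\<And>q. q \<in> V \<Longrightarrow> (F has_derivative F' q) (at q)"
    and A: "\<And>q. q \<in> V \<Longrightarrow> ((\<lambda>q. F' q v) has_derivative A q) (at q)"
    and B: "\<And>q. q \<in> V \<Longrightarrow> ((\<lambda>q. F' q w) has_derivative B q) (at q)"
    and "isCont (\<lambda>q. A q w) p" "isCont (\<lambda>q. B q v) p"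
  shows "A p w = B p v"
proof (rule ccontr)
  assume "A p w \<noteq> B p v"
  \<comment> \<open>Half the gap: one number cannot lie strictly within \<open>e\<close> of both
    values.\<close>
  define e where "e = \<bar>A p w - B p v\<bar> / 2"
  have e: "e > 0" using \<open>A p w \<noteq> B p v\<close> by (simp add: e_def)
  obtain d1 where d1: "d1 > 0" "ball p d1 \<subseteq> V"
    using assms(1,2) open_contains_ball by blast
  obtain d2 where d2: "d2 > 0" "\<And>q. dist q p < d2 \<Longrightarrow> \<bar>A q w - A p w\<bar> < e"
    using assms(6) e unfolding continuous_at_eps_delta by (metis dist_real_def)
  obtain d3 where d3: "d3 > 0" "\<And>q. dist q p < d3 \<Longrightarrow> \<bar>B q v - B p v\<bar> < e"
    using assms(7) e unfolding continuous_at_eps_delta by (metis dist_real_def)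
  define d where "d = min d1 (min d2 d3)"
  \<comment> \<open>Small enough for the parallelogram with corner \<open>p\<close> and sides
    \<open>h *\<^sub>R v\<close>, \<open>h *\<^sub>R w\<close> to stay within \<open>d\<close> of
    \<open>p\<close>; the summand 1 keeps the denominator positive when both vectors vanish.\<close>
  define h where "h = d / (norm v + norm w + 1)"
  have d: "d > 0" using d1 d2 d3 by (simp add: d_def)
  have pos: "norm v + norm w + 1 > 0" using norm_ge_zero[of v] norm_ge_zero[of w] by linarith
  then have h: "h > 0" using d by (simp add: h_def)
  have near: "dist (p + s *\<^sub>R v + t *\<^sub>R w) p < d" if "0 \<le> s" "s \<le> h" "0 \<le> t" "t \<le> h" for s t
  proof -
    have "dist (p + s *\<^sub>R v + t *\<^sub>R w) p = norm (s *\<^sub>R v + t *\<^sub>R w)"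
      by (simp add: dist_norm algebra_simps)
    also have "\<dots> \<le> s * norm v + t * norm w"
      using that by (metis abs_of_nonneg norm_scaleR norm_triangle_ineq)
    also have "\<dots> \<le> h * norm v + h * norm w"
      using that by (intro add_mono mult_right_mono) auto
    also have "\<dots> < h * (norm v + norm w + 1)"
      using h by (simp add: algebra_simps)
    also have "\<dots> = d" using pos by (simp add: h_def)
    finally show ?thesis .
  qed
  have in_V: "p + s *\<^sub>R v + t *\<^sub>R w \<in> V" "p + t *\<^sub>R w + s *\<^sub>R v \<in> V"
    if "0 \<le> s" "s \<le> h" "0 \<le> t" "t \<le> h" for s t
    using near[OF that] d1 by (auto simp: d_def dist_commute ac_simps)
  obtain s t where st: "0 < s" "s < h" "0 < t" "t < h"
    "F (p + h *\<^sub>R v + h *\<^sub>R w) - F (p + h *\<^sub>R v) - F (p + h *\<^sub>R w) + F p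
       = h * h * A (p + s *\<^sub>R v + t *\<^sub>R w) w"
    by (rule second_difference_MVT[OF h, of p v w V F F' A]) ((rule in_V F' A; assumption) | blast)+
  obtain t' s' where st': "0 < t'" "t' < h" "0 < s'" "s' < h"
    "F (p + h *\<^sub>R w + h *\<^sub>R v) - F (p + h *\<^sub>R w) - F (p + h *\<^sub>R v) + F p
       = h * h * B (p + t' *\<^sub>R w + s' *\<^sub>R v) v"
    by (rule second_difference_MVT[OF h, of p w v V F F' B]) ((rule in_V F' B; assumption) | blast)+
  have "h * h * A (p + s *\<^sub>R v + t *\<^sub>R w) w = h * h * B (p + s' *\<^sub>R v + t' *\<^sub>R w) v"
  proof -
    have eq: "p + h *\<^sub>R w + h *\<^sub>R v = p + h *\<^sub>R v + h *\<^sub>R w"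
      "p + t' *\<^sub>R w + s' *\<^sub>R v = p + s' *\<^sub>R v + t' *\<^sub>R w" by (simp_all add: ac_simps)
    show ?thesis using st(5) st'(5)[unfolded eq] by linarith
  qed
  then have "A (p + s *\<^sub>R v + t *\<^sub>R w) w = B (p + s' *\<^sub>R v + t' *\<^sub>R w) v"
    using h by simp
  moreover have "\<bar>A (p + s *\<^sub>R v + t *\<^sub>R w) w - A p w\<bar> < e"
    using near[of s t] st by (intro d2) (auto simp: d_def)
  moreover have "\<bar>B (p + s' *\<^sub>R v + t' *\<^sub>R w) v - B p v\<bar> < e"
    using near[of s' t'] st' by (intro d3) (auto simp: d_def)
  ultimately show False unfolding e_def by (smt (verit) field_sum_of_halves)
qed


subsection \<open>Smooth functions\<close>

lemma Ck_on_subset: "Ck_on k V F \<Longrightarrow> W \<subseteq> V \<Longrightarrow> Ck_on k W F"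
  by (induction k arbitrary: F) (auto intro: continuous_on_subset)

lemma Ck_on_Suc_iff:
  "Ck_on (Suc k) V F \<longleftrightarrow> (\<forall>q\<in>V. F differentiable (at q)) \<and>
     (\<forall>w. Ck_on k V (\<lambda>q. frechet_derivative F (at q) w))"
  by (rule Ck_on.simps(2))

lemma Ck_on_frechet_derivative:
  assumes "Ck_on (Suc k) V F"
  shows "q \<in> V \<Longrightarrow> F differentiable (at q)"
    and "q \<in> V \<Longrightarrow> (F has_derivative frechet_derivative F (at q)) (at q)"
    and "q \<in> V \<Longrightarrow> linear (frechet_derivative F (at q))"
    and "Ck_on k V (\<lambda>q. frechet_derivative F (at q) w)"
  using assms unfolding Ck_on_Suc_iff
  by (blast intro: frechet_derivative_works[THEN iffD1] linear_frechet_derivative)+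

text \<open>On an open set, equal functions have equal derivatives at each point, so the induction
  can pass to the derivatives. It is used where a formula for a derivative is known on
  \<open>V\<close> only.\<close>

lemma Ck_on_cong:
  assumes "open V" "\<And>q. q \<in> V \<Longrightarrow> F q = G q" "Ck_on k V F"
  shows "Ck_on k V G"
  using assms(2,3)
proof (induction k arbitrary: F G)
  case 0
  then show ?case using continuous_on_cong[of V V F G] by simp
next
  case (Suc k)
  note C = Ck_on_frechet_derivative[OF Suc.prems(2)]
  have G: "(G has_derivative frechet_derivative F (at q)) (at q)" if "q \<in> V" for q
    using C(2)[OF that] \<open>open V\<close> that Suc.prems(1) by (rule has_derivative_transform_within_open)
  then have "frechet_derivative F (at q) w = frechet_derivative G (at q) w" if "q \<in> V" for q w
    using that by (intro fun_cong[OF frechet_derivative_at]) auto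
  then have "Ck_on k V (\<lambda>q. frechet_derivative G (at q) w)" for w
    by (rule Suc.IH[OF _ C(4)])
  with G show ?case unfolding Ck_on_Suc_iff by (blast intro: differentiableI)
qed

lemma Ck_on_diff:
  assumes "open V" "Ck_on k V F" "Ck_on k V G"
  shows "Ck_on k V (\<lambda>q. F q - G q)"
  using assms(2,3)
proof (induction k arbitrary: F G)
  case 0
  then show ?case by (simp add: continuous_on_diff)
next
  case (Suc k)
  note CF = Ck_on_frechet_derivative[OF Suc.prems(1)]
  note CG = Ck_on_frechet_derivative[OF Suc.prems(2)]
  have D: "((\<lambda>q. F q - G q) has_derivative
      (\<lambda>w. frechet_derivative F (at q) w - frechet_derivative G (at q) w)) (at q)" if "q \<in> V" for q
    using CF(2)[OF that] CG(2)[OF that] by (rule has_derivative_diff)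
  have "frechet_derivative F (at q) w - frechet_derivative G (at q) w
      = frechet_derivative (\<lambda>q. F q - G q) (at q) w" if "q \<in> V" for q w
    using fun_cong[OF frechet_derivative_at[OF D[OF that]]] .
  moreover have "Ck_on k V (\<lambda>q. frechet_derivative F (at q) w - frechet_derivative G (at q) w)" for w
    using CF(4) CG(4) by (rule Suc.IH)
  ultimately have "Ck_on k V (\<lambda>q. frechet_derivative (\<lambda>q. F q - G q) (at q) w)" for w
    by (rule Ck_on_cong[OF \<open>open V\<close>])
  with D show ?case unfolding Ck_on_Suc_iff by (blast intro: differentiableI)
qed

lemma Ck_on_const: "Ck_on k V (\<lambda>q. c)"
  by (induction k arbitrary: c) (simp_all add: frechet_derivative_const)

text \<open>The derivative in a direction \<open>w\<close> is the constant \<open>L w\<close>, so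
  one differentiation reduces the claim to constants.\<close>

lemma Ck_on_linear:
  assumes "linear L"
  shows "Ck_on k V L"
proof (cases k)
  case 0
  then show ?thesis using assms by (simp add: linear_continuous_on linear_conv_bounded_linear)
next
  case (Suc n)
  have "(L has_derivative L) (at q)" for q
    using assms by (simp add: bounded_linear_imp_has_derivative linear_conv_bounded_linear)
  then have "L differentiable (at q)" "frechet_derivative L (at q) = L" for q
    by (blast intro: differentiableI, blast intro: frechet_derivative_at[symmetric])
  then show ?thesis using Suc by (simp add: Ck_on_const)
qed

text \<open>Such a form is its own smooth extension, on the whole ambient space.\<close>

lemma smooth_one_form_on_bilinear:
  assumes "\<And>q. linear (\<beta> q)" "\<And>w. linear (\<lambda>q. \<beta> q w)"
  shows "smooth_one_form_on U \<beta>"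
  unfolding smooth_one_form_on_def ambient_smooth_on_def
  using assms by (blast intro: Ck_on_linear open_UNIV UNIV_I)

lemma smooth_second_derivative_symmetric:
  assumes "open V" "p \<in> V" "\<And>k. Ck_on k V F"
  shows "frechet_derivative (\<lambda>q. frechet_derivative F (at q) v) (at p) w
    = frechet_derivative (\<lambda>q. frechet_derivative F (at q) w) (at p) v"
proof (rule second_derivative_symmetric[OF assms(1,2)])
  have "Ck_on 2 V F" by (rule assms(3))
  note C = this[unfolded numeral_2_eq_2]
  note C1 = Ck_on_frechet_derivative(4)[OF C]
  show "(F has_derivative frechet_derivative F (at q)) (at q)" if "q \<in> V" for q
    using Ck_on_frechet_derivative(2)[OF C that] .
  show "((\<lambda>q. frechet_derivative F (at q) u) has_derivative
      frechet_derivative (\<lambda>q. frechet_derivative F (at q) u) (at q)) (at q)" if "q \<in> V" for q u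
    using Ck_on_frechet_derivative(2)[OF C1 that] .
  then show "((\<lambda>q. frechet_derivative F (at q) w) has_derivative
      frechet_derivative (\<lambda>q. frechet_derivative F (at q) w) (at q)) (at q)" if "q \<in> V" for q
    using that .
  have "continuous_on V (\<lambda>q. frechet_derivative (\<lambda>q. frechet_derivative F (at q) u) (at q) z)" for u z
    using Ck_on_frechet_derivative(4)[OF C1] by simp
  then show "isCont (\<lambda>q. frechet_derivative (\<lambda>q. frechet_derivative F (at q) v) (at q) w) p"
    "isCont (\<lambda>q. frechet_derivative (\<lambda>q. frechet_derivative F (at q) w) (at q) v) p"
    using assms(1,2) continuous_on_eq_continuous_at by blast+
qed


subsection \<open>The differential and its exterior derivative\<close>

lemma SU2_iff_inner: "q \<in> SU2 \<longleftrightarrow> inner q q = 1"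
  by (cases q) (simp add: SU2_def inner_prod_def power2_eq_square algebra_simps)

lemma proj_tangent: "q \<in> SU2 \<Longrightarrow> proj q w \<in> tangent q"
  by (simp add: SU2_iff_inner proj_def tangent_def inner_diff_left)

text \<open>Within \<open>SU2\<close> the operator \<open>frechet_derivative\<close> selects one of
  several possible derivatives; on tangent vectors they all coincide with \<open>D\<close>.\<close>

lemma frechet_derivative_within_SU2:
  fixes f :: "quat \<Rightarrow> real"
  assumes "(f has_derivative D) (at p within SU2)" "p \<in> SU2" "v \<in> tangent p"
  shows "frechet_derivative f (at p within SU2) v = D v"
  using assms derivative_within_SU2_unique by (metis differentiableI frechet_derivative_works)

lemma ext_deriv_eq:
  assumes "p \<in> SU2" "v \<in> tangent p" "w \<in> tangent p"
    and "((\<lambda>q. \<omega> q (proj q w)) has_derivative A) (at p within SU2)"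
    and "((\<lambda>q. \<omega> q (proj q v)) has_derivative B) (at p within SU2)"
  shows "ext_deriv \<omega> p v w = A v - B w"
  unfolding ext_deriv_def
  using frechet_derivative_within_SU2[OF assms(4,1,2)] frechet_derivative_within_SU2[OF assms(5,1,3)]
  by simp

text \<open>A local ambient extension of \<open>f\<close>, through which derivatives within
  \<open>SU2\<close> become honest derivatives on an open set of the ambient space.\<close>

locale smooth_extension =
  fixes V :: "quat set" and F f :: "quat \<Rightarrow> real"
  assumes V: "open V" and F: "\<And>k. Ck_on k V F"
    and Ff: "\<And>q. q \<in> V \<Longrightarrow> q \<in> SU2 \<Longrightarrow> F q = f q"
begin

lemma has_derivative_within_SU2:
  assumes "q \<in> V" "q \<in> SU2"
  shows "(f has_derivative frechet_derivative F (at q)) (at q within SU2)"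
proof -
  have "(F has_derivative frechet_derivative F (at q)) (at q within SU2)"
    using Ck_on_frechet_derivative(2)[OF F assms(1)] by (rule has_derivative_at_withinI)
  moreover have "\<forall>\<^sub>F x in at q within SU2. F x = f x"
    using V assms Ff unfolding eventually_at_topological by blast
  ultimately show ?thesis
    using Ff[OF assms] assms(2) by (rule has_derivative_transform_eventually)
qed

lemma differential_eq:
  assumes "q \<in> V" "q \<in> SU2" "v \<in> tangent q"
  shows "differential f q v = frechet_derivative F (at q) v"
  unfolding differential_def
  by (rule frechet_derivative_within_SU2[OF has_derivative_within_SU2]) (use assms in auto)

text \<open>\<open>Ck_on\<close> controls derivatives in fixed directions only. Expanding the moving
  direction \<open>L q\<close> in the standard basis gives a finite sum of products of
  differentiable functions. It is applied with \<open>L\<close> the identity and with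
  \<open>L\<close> the left multiplication by i.\<close>

lemma frechet_derivative_along_differentiable:
  assumes "bounded_linear L" "q \<in> V"
  shows "(\<lambda>q. frechet_derivative F (at q) (L q)) differentiable (at q)"
proof -
  have eq: "frechet_derivative F (at r) (L r) = (\<Sum>b\<in>Basis. inner (L r) b * frechet_derivative F (at r) b)"
    if "r \<in> V" for r
  proof -
    have "frechet_derivative F (at r) (L r)
        = frechet_derivative F (at r) (\<Sum>b\<in>Basis. inner (L r) b *\<^sub>R b)"
      by (simp add: euclidean_representation)
    also have "\<dots> = (\<Sum>b\<in>Basis. inner (L r) b * frechet_derivative F (at r) b)"
      using Ck_on_frechet_derivative(3)[OF F that] by (simp add: linear_sum linear_cmul)
    finally show ?thesis .
  qed
  have "(\<lambda>r. \<Sum>b\<in>Basis. inner (L r) b * frechet_derivative F (at r) b) differentiable (at q)"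
  proof -
    have "(\<lambda>r. frechet_derivative F (at r) b) differentiable (at q)" for b
      using Ck_on_frechet_derivative(1)[OF Ck_on_frechet_derivative(4)[OF F] assms(2)] .
    moreover have "(\<lambda>r. inner (L r) b) differentiable (at q)" for b
      using bounded_linear_compose[OF bounded_linear_inner_left assms(1)]
      by (rule bounded_linear_imp_differentiable)
    ultimately show ?thesis by (intro differentiable_sum differentiable_mult) auto
  qed
  then obtain D where "((\<lambda>r. \<Sum>b\<in>Basis. inner (L r) b * frechet_derivative F (at r) b)
      has_derivative D) (at q)"
    unfolding differentiable_def ..
  then have "((\<lambda>r. frechet_derivative F (at r) (L r)) has_derivative D) (at q)"
    using V assms(2) eq[symmetric] by (rule has_derivative_transform_within_open)
  then show ?thesis by (rule differentiableI)
qed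

text \<open>The function is \<open>F' q u - inner u q * F' q q\<close>, with \<open>F'\<close> the
  derivative of \<open>F\<close>. Since \<open>inner u p = 0\<close>, the product rule leaves at
  \<open>p\<close> only the term that differentiates \<open>inner u q\<close>.\<close>

lemma differential_proj_has_derivative:
  assumes "p \<in> V" "p \<in> SU2" "u \<in> tangent p"
  shows "((\<lambda>q. differential f q (proj q u)) has_derivative
    (\<lambda>x. frechet_derivative (\<lambda>q. frechet_derivative F (at q) u) (at p) x
       - inner u x * frechet_derivative F (at p) p)) (at p within SU2)"
proof -
  define C where "C = frechet_derivative (\<lambda>q. frechet_derivative F (at q) q) (at p)"
  have "((\<lambda>q. frechet_derivative F (at q) q) has_derivative C) (at p)"
    unfolding C_def using frechet_derivative_along_differentiable[OF bounded_linear_ident assms(1)]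
    by (rule frechet_derivative_works[THEN iffD1])
  moreover have "((\<lambda>q. frechet_derivative F (at q) u) has_derivative
      frechet_derivative (\<lambda>q. frechet_derivative F (at q) u) (at p)) (at p)"
    using Ck_on_frechet_derivative(2)[OF Ck_on_frechet_derivative(4)[OF F] assms(1)] .
  moreover have "inner u p = 0" using assms(3) by (simp add: tangent_def)
  ultimately have "((\<lambda>q. frechet_derivative F (at q) u - inner u q * frechet_derivative F (at q) q)
      has_derivative (\<lambda>x. frechet_derivative (\<lambda>q. frechet_derivative F (at q) u) (at p) x
       - inner u x * frechet_derivative F (at p) p)) (at p)"
    by (auto intro!: derivative_eq_intros)
  then have D: "((\<lambda>q. frechet_derivative F (at q) u - inner u q * frechet_derivative F (at q) q)
      has_derivative (\<lambda>x. frechet_derivative (\<lambda>q. frechet_derivative F (at q) u) (at p) x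
       - inner u x * frechet_derivative F (at p) p)) (at p within SU2)"
    by (rule has_derivative_at_withinI)
  have eq: "frechet_derivative F (at q) u - inner u q * frechet_derivative F (at q) q
      = differential f q (proj q u)" if "q \<in> V" "q \<in> SU2" for q
    using that Ck_on_frechet_derivative(3)[OF F that(1)]
    by (simp add: differential_eq proj_tangent) (simp add: proj_def linear_diff linear_cmul)
  then have "\<forall>\<^sub>F q in at p within SU2. frechet_derivative F (at q) u
      - inner u q * frechet_derivative F (at q) q = differential f q (proj q u)"
    using V assms unfolding eventually_at_topological by blast
  then show ?thesis
    using eq[OF assms(1,2)] assms(2) by (rule has_derivative_transform_eventually[OF D])
qed

text \<open>This is d(df) = 0 in the form needed for \<omega>2: the second derivative of
  \<open>F\<close> is symmetric, and so is the correction \<open>inner u x * F' p p\<close> caused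
  by the projection, hence both cancel in the antisymmetrization.\<close>

lemma ext_deriv_differential_diff:
  assumes "p \<in> V" "p \<in> SU2" "v \<in> tangent p" "w \<in> tangent p"
    and "\<And>q u. \<omega> q (proj q u) = \<omega> q u" "\<And>u. linear (\<lambda>q. \<omega> q u)"
  shows "ext_deriv (\<lambda>p v. differential f p v - \<omega> p v) p v w = - ext_deriv \<omega> p v w"
proof -
  have "((\<lambda>q. \<omega> q (proj q u)) has_derivative (\<lambda>q. \<omega> q u)) (at p within SU2)" for u :: quat
    using assms(5,6) by (simp add: bounded_linear_imp_has_derivative linear_conv_bounded_linear)
  then have D: "((\<lambda>q. differential f q (proj q u) - \<omega> q (proj q u)) has_derivative
      (\<lambda>x. frechet_derivative (\<lambda>q. frechet_derivative F (at q) u) (at p) x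
       - inner u x * frechet_derivative F (at p) p - \<omega> x u)) (at p within SU2)"
    if "u \<in> tangent p" for u
    using differential_proj_has_derivative[OF assms(1,2) that] by (intro has_derivative_diff)
  show ?thesis
    using ext_deriv_eq[where \<omega> = "\<lambda>p v. differential f p v - \<omega> p v",
        OF assms(2-4) D[OF assms(4)] D[OF assms(3)]]
      smooth_second_derivative_symmetric[OF V assms(1) F, of v w] ext_deriv_bilinear[OF assms(2-6)]
    by (simp add: inner_commute)
qed

end


section \<open>Local extensions of smooth functions on the group\<close>

text \<open>The domain of the extension is cut down by an open set that traces out \<open>U\<close>,
  so that agreement on \<open>V \<inter> U\<close> becomes agreement on all of
  \<open>V \<inter> SU2\<close>.\<close>

lemma smooth_function_on_extension:
  assumes "openin (top_of_set SU2) U" "smooth_function_on U f" "p \<in> U"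
  obtains V F where "smooth_extension V F f" "p \<in> V" "V \<inter> SU2 \<subseteq> U"
proof -
  obtain T where T: "open T" "U = SU2 \<inter> T" using assms(1) by (auto simp: openin_open)
  obtain V F where "p \<in> V" "ambient_smooth_on V F" and Ff: "\<forall>q\<in>V \<inter> U. F q = f q"
    using assms(2,3) unfolding smooth_function_on_def by blast
  then have VF: "p \<in> V" "open V" "\<And>k. Ck_on k V F"
    unfolding ambient_smooth_on_def by blast+
  show thesis
  proof (rule that)
    show "smooth_extension (V \<inter> T) F f"
    proof
      show "open (V \<inter> T)" using VF T by auto
      show "Ck_on k (V \<inter> T) F" for k using VF(3) Ck_on_subset by blast
      show "F q = f q" if "q \<in> V \<inter> T" "q \<in> SU2" for q using Ff T that by blast
    qed
    show "p \<in> V \<inter> T" "V \<inter> T \<inter> SU2 \<subseteq> U" using VF T assms(3) by auto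
  qed
qed

lemma smooth_function_on_continuous:
  assumes "openin (top_of_set SU2) U" "smooth_function_on U f"
  shows "continuous_on U f"
  unfolding continuous_on_eq_continuous_within
proof
  fix p assume "p \<in> U"
  then obtain V F where "smooth_extension V F f" "p \<in> V"
    by (rule smooth_function_on_extension[OF assms])
  moreover have "U \<subseteq> SU2" using assms(1) openin_imp_subset by blast
  ultimately have "continuous (at p within SU2) f"
    using \<open>p \<in> U\<close>
    by (intro has_derivative_continuous[OF smooth_extension.has_derivative_within_SU2]) auto
  then show "continuous (at p within U) f"
    using \<open>U \<subseteq> SU2\<close> by (rule continuous_within_subset)
qed

lemma smooth_one_form_on_differential_diff:
  assumes "openin (top_of_set SU2) U" "smooth_function_on U f"
    and "\<And>q. linear (\<omega> q)" "\<And>w. linear (\<lambda>q. \<omega> q w)"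
  shows "smooth_one_form_on U (\<lambda>p v. differential f p v - \<omega> p v)"
  unfolding smooth_one_form_on_def
proof
  fix p assume "p \<in> U"
  then obtain V F where ext: "smooth_extension V F f" and "p \<in> V"
    by (rule smooth_function_on_extension[OF assms(1,2)])
  interpret smooth_extension V F f by (rule ext)
  have "U \<subseteq> SU2" using assms(1) openin_imp_subset by blast
  define \<beta> where "\<beta> q w = frechet_derivative F (at q) w - \<omega> q w" for q w
  have "linear (\<beta> q)" if "q \<in> V" for q
    unfolding \<beta>_def using Ck_on_frechet_derivative(3)[OF F that] assms(3)
    by (intro linear_compose_sub)
  moreover have "ambient_smooth_on V (\<lambda>q. \<beta> q w)" for w
    unfolding \<beta>_def ambient_smooth_on_def
    using V Ck_on_diff[OF V Ck_on_frechet_derivative(4)[OF F] Ck_on_linear[OF assms(4)]] by blast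
  moreover have "\<beta> q v = differential f q v - \<omega> q v" if "q \<in> V \<inter> U" "v \<in> tangent q" for q v
    using that \<open>U \<subseteq> SU2\<close> differential_eq[of q v] by (auto simp: \<beta>_def)
  ultimately show "\<exists>V \<beta>. p \<in> V \<and> (\<forall>q\<in>V. linear (\<beta> q)) \<and>
      (\<forall>w. ambient_smooth_on V (\<lambda>q. \<beta> q w)) \<and>
      (\<forall>q\<in>V \<inter> U. \<forall>v\<in>tangent q. \<beta> q v = differential f q v - \<omega> q v)"
    using \<open>p \<in> V\<close> by blast
qed


subsection \<open>The Hopf quotient\<close>

text \<open>
  With \<open>z = a0 + i a1\<close> and \<open>w = b0 + i b1\<close> these are the real and imaginary part of \<open>cnj z * w\<close>,
  which is invariant under left multiplication by \<open>cos t + i sin t\<close>.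
\<close>

fun hopf_re :: "quat \<Rightarrow> real" where
  "hopf_re (a0, a1, b0, b1) = a0 * b0 + a1 * b1"

fun hopf_im :: "quat \<Rightarrow> real" where
  "hopf_im (a0, a1, b0, b1) = a0 * b1 - a1 * b0"

lemma has_arctan_formD:
  "has_arctan_form U \<Phi> f \<Longrightarrow> p \<in> U \<Longrightarrow> hopf_im p \<noteq> 0 \<Longrightarrow> f p = \<Phi> (arctan (hopf_re p / hopf_im p))"
  by (cases p) (auto simp: has_arctan_form_def)

lemma great_circle_in_SU2:
  assumes "p \<in> SU2" "v \<in> SU2" "v \<in> tangent p"
  shows "cos t *\<^sub>R p + sin t *\<^sub>R v \<in> SU2"
proof -
  have "inner v p = 0" "inner p v = 0" using assms(3) by (simp_all add: tangent_def inner_commute)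
  then have "inner (cos t *\<^sub>R p + sin t *\<^sub>R v) (cos t *\<^sub>R p + sin t *\<^sub>R v) = (cos t)\<^sup>2 + (sin t)\<^sup>2"
    using assms(1,2) by (simp add: SU2_iff_inner inner_add_left inner_add_right power2_eq_square)
  then show ?thesis by (simp add: SU2_iff_inner)
qed

lemma eventually_great_circle_in:
  assumes "openin (top_of_set SU2) U" "p \<in> U" "v \<in> SU2" "v \<in> tangent p"
  shows "\<forall>\<^sub>F t in nhds 0. cos t *\<^sub>R p + sin t *\<^sub>R v \<in> U"
proof -
  obtain T where T: "open T" "U = SU2 \<inter> T" using assms(1) by (auto simp: openin_open)
  have "((\<lambda>t::real. cos t *\<^sub>R p + sin t *\<^sub>R v) \<longlongrightarrow> cos 0 *\<^sub>R p + sin 0 *\<^sub>R v) (nhds 0)"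
    by (intro tendsto_intros filterlim_ident)
  then have "\<forall>\<^sub>F t in nhds 0. cos t *\<^sub>R p + sin t *\<^sub>R v \<in> T"
    using T assms(2) by (intro topological_tendstoD) auto
  then show ?thesis
    using T assms great_circle_in_SU2 by (auto elim!: eventually_mono)
qed

text \<open>
  At a zero of \<open>hopf_im\<close> its ambient gradient is a unit tangent vector, and along the great circle
  in that direction \<open>hopf_im\<close> equals \<open>sin t * cos t\<close>.
\<close>

lemma eq_zero_if_zero_off_hopf_im:
  fixes G :: "quat \<Rightarrow> real"
  assumes "openin (top_of_set SU2) U" "continuous_on U G"
    and zero: "\<And>q. q \<in> U \<Longrightarrow> hopf_im q \<noteq> 0 \<Longrightarrow> G q = 0"
    and "p \<in> U"
  shows "G p = 0"
proof (cases "hopf_im p = 0")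
  case True
  obtain a0 a1 b0 b1 where p: "p = (a0, a1, b0, b1)" by (cases p)
  define v where "v = (b1, - b0, - a1, a0)"
  have "p \<in> SU2" using assms(1,4) openin_imp_subset by blast
  then have N: "a0 * a0 + a1 * a1 + b0 * b0 + b1 * b1 = 1"
    by (simp add: p SU2_def power2_eq_square)
  \<comment> \<open>Tangency uses the assumption on \<open>p\<close>, because
    \<open>inner v p = 2 * hopf_im p\<close>.\<close>
  have v: "v \<in> SU2" "v \<in> tangent p"
    using N True
    by (simp_all add: v_def p SU2_def tangent_def inner_prod_def power2_eq_square mult.commute)
  define c where "c t = cos t *\<^sub>R p + sin t *\<^sub>R v" for t
  have "hopf_im (C *\<^sub>R p + S *\<^sub>R v)
      = S * C * (a0 * a0 + a1 * a1 + b0 * b0 + b1 * b1) + (C * C + S * S) * hopf_im p" for C S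
    by (simp add: p v_def algebra_simps)
  then have im: "hopf_im (c t) = sin t * cos t" for t
    by (simp add: c_def True N)
  have c_U: "\<forall>\<^sub>F t in at 0. c t \<in> U"
    using eventually_great_circle_in[OF assms(1,4) v] unfolding c_def
    by (simp add: eventually_nhds_conv_at)
  \<comment> \<open>On this punctured interval neither the sine nor the cosine vanishes, so the
    circle avoids the zeros of \<open>hopf_im\<close>.\<close>
  have "\<forall>\<^sub>F t::real in at 0. t \<in> {- (pi / 2)<..<pi / 2} - {0}"
    by (rule eventually_at_in_open) auto
  with c_U have "\<forall>\<^sub>F t in at 0. G (c t) = 0"
  proof eventually_elim
    case (elim t)
    then have "cos t \<noteq> 0" using cos_gt_zero_pi[of t] by auto
    moreover have "sin t \<noteq> 0"
      using elim sin_eq_0_pi[of t] by auto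
    ultimately show ?case using elim zero im by simp
  qed
  then have "((\<lambda>t. G (c t)) \<longlongrightarrow> 0) (at 0)"
    by (simp add: tendsto_eventually)
  moreover have "((\<lambda>t. G (c t)) \<longlongrightarrow> G p) (at 0)"
  proof (rule continuous_on_tendsto_compose[OF assms(2) _ assms(4) c_U])
    have "((\<lambda>t::real. cos t *\<^sub>R p + sin t *\<^sub>R v) \<longlongrightarrow> cos 0 *\<^sub>R p + sin 0 *\<^sub>R v) (at 0)"
      by (intro tendsto_intros)
    then show "(c \<longlongrightarrow> p) (at 0)" by (simp add: c_def[abs_def])
  qed
  ultimately show ?thesis using tendsto_unique[OF at_neq_bot] by blast
qed (use assms in auto)


subsection \<open>The right-invariant frame\<close>

text \<open>Left multiplication by a purely imaginary quaternion is skew-adjoint.\<close>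

lemma frame_tangent: "qmult (0, x) p \<in> tangent p"
  by (cases x; cases p) (simp add: tangent_def inner_prod_def algebra_simps)

lemma frame_in_SU2: "p \<in> SU2 \<Longrightarrow> qmult (0, 1, 0, 0) p \<in> SU2"
  by (cases p) (simp add: SU2_def)

text \<open>The forms are the components of dg g^-1 in the basis j/2, k/2, i/2, so the
  right-invariant fields jp, kp, ip are twice the dual frame.\<close>

lemma alpha_frame:
  assumes "p \<in> SU2"
  shows "\<alpha>1 p (qmult (0, 0, 1, 0) p) = 2" "\<alpha>1 p (qmult (0, 0, 0, 1) p) = 0"
    "\<alpha>1 p (qmult (0, 1, 0, 0) p) = 0"
    "\<alpha>2 p (qmult (0, 0, 1, 0) p) = 0" "\<alpha>2 p (qmult (0, 0, 0, 1) p) = 2"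
    "\<alpha>2 p (qmult (0, 1, 0, 0) p) = 0"
    "\<alpha>3 p (qmult (0, 0, 1, 0) p) = 0" "\<alpha>3 p (qmult (0, 0, 0, 1) p) = 0"
    "\<alpha>3 p (qmult (0, 1, 0, 0) p) = 2"
  using assms by (cases p; simp add: SU2_def power2_eq_square algebra_simps)+

lemma tangent_frame_expansion:
  assumes "p \<in> SU2" "v \<in> tangent p"
  shows "v = (\<alpha>1 p v / 2) *\<^sub>R qmult (0, 0, 1, 0) p + (\<alpha>2 p v / 2) *\<^sub>R qmult (0, 0, 0, 1) p
    + (\<alpha>3 p v / 2) *\<^sub>R qmult (0, 1, 0, 0) p"
proof -
  obtain a0 a1 b0 b1 where p: "p = (a0, a1, b0, b1)" by (cases p)
  obtain x y z where v: "v = (- b0 * x - b1 * y - a1 * z, b1 * x - b0 * y + a0 * z,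
      a0 * x + a1 * y - b1 * z, - a1 * x + a0 * y + b0 * z)"
    and \<alpha>: "\<alpha>1 p v = 2 * x" "\<alpha>2 p v = 2 * y" "\<alpha>3 p v = 2 * z"
    using tangent_frame assms unfolding p by metis
  show ?thesis unfolding \<alpha> by (simp add: v p algebra_simps)
qed

text \<open>Evaluation on the frame determines all three coefficients, which justifies the definite
  description in \<open>directional_derivs\<close>; the condition on \<open>D\<close> kills the
  coefficient of \<alpha>3.\<close>

lemma differential_directional_derivs:
  assumes "p \<in> SU2" "linear D" "\<And>v. v \<in> tangent p \<Longrightarrow> differential f p v = D v"
    and "D (qmult (0, 1, 0, 0) p) = 0" "v \<in> tangent p"
  shows "differential f p v = d_\<alpha>1 f p * \<alpha>1 p v + d_\<alpha>2 f p * \<alpha>2 p v"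
proof -
  define c where "c = (D (qmult (0, 0, 1, 0) p) / 2, D (qmult (0, 0, 0, 1) p) / 2, 0 :: real)"
  have c: "differential f p v = fst c * \<alpha>1 p v + fst (snd c) * \<alpha>2 p v + snd (snd c) * \<alpha>3 p v"
    if "v \<in> tangent p" for v
  proof -
    have "D v = D ((\<alpha>1 p v / 2) *\<^sub>R qmult (0, 0, 1, 0) p + (\<alpha>2 p v / 2) *\<^sub>R qmult (0, 0, 0, 1) p
        + (\<alpha>3 p v / 2) *\<^sub>R qmult (0, 1, 0, 0) p)"
      using tangent_frame_expansion[OF assms(1) that] by (rule arg_cong)
    then show ?thesis
      using that assms(3,4) by (simp add: c_def linear_add[OF assms(2)] linear_cmul[OF assms(2)] mult.commute)
  qed
  have "directional_derivs f p = c"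
    unfolding directional_derivs_def
  proof (rule the_equality)
    show "\<forall>v\<in>tangent p. differential f p v
        = fst c * \<alpha>1 p v + fst (snd c) * \<alpha>2 p v + snd (snd c) * \<alpha>3 p v"
      using c by blast
  next
    fix e :: "real \<times> real \<times> real"
    assume "\<forall>v\<in>tangent p. differential f p v
        = fst e * \<alpha>1 p v + fst (snd e) * \<alpha>2 p v + snd (snd e) * \<alpha>3 p v"
    then have eq: "fst e * \<alpha>1 p v + fst (snd e) * \<alpha>2 p v + snd (snd e) * \<alpha>3 p v
        = fst c * \<alpha>1 p v + fst (snd c) * \<alpha>2 p v + snd (snd c) * \<alpha>3 p v"
      if "v \<in> tangent p" for v
      using c that by simp
    show "e = c"
      using eq[OF frame_tangent, of "(0, 1, 0)"] eq[OF frame_tangent, of "(0, 0, 1)"]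
        eq[OF frame_tangent, of "(1, 0, 0)"]
      by (simp add: alpha_frame[OF assms(1)] prod_eq_iff)
  qed
  then show ?thesis using c[OF assms(5)] by (simp add: d_\<alpha>1_def d_\<alpha>2_def c_def)
qed


subsection \<open>Invariance under the binary dihedral group\<close>

lemma linear_qmult_left: "linear (\<lambda>q. qmult q x)"
  by (cases x) (auto intro!: linearI simp: algebra_simps)

lemma qmult_has_derivative: "((\<lambda>q. qmult q x) has_derivative (\<lambda>v. qmult v x)) (at p within S)"
  using linear_qmult_left by (simp add: bounded_linear_imp_has_derivative linear_conv_bounded_linear)

lemma pullback_qmult: "pullback (\<lambda>g. qmult g x) \<omega> p v = \<omega> (qmult p x) (qmult v x)"
  using frechet_derivative_at[OF qmult_has_derivative, of x p] by (simp add: pullback_def)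

text \<open>A right factor x cancels in (dg x)(g x)^-1 = dg g^-1.\<close>

lemma alpha_right_invariant:
  assumes "x \<in> D8"
  shows "\<alpha>1 (qmult p x) (qmult v x) = \<alpha>1 p v" "\<alpha>2 (qmult p x) (qmult v x) = \<alpha>2 p v"
    "\<alpha>3 (qmult p x) (qmult v x) = \<alpha>3 p v"
  using assms by (cases p; cases v; auto simp: D8_def)+

lemma qmult_tangent: "x \<in> D8 \<Longrightarrow> v \<in> tangent p \<Longrightarrow> qmult v x \<in> tangent (qmult p x)"
  by (cases p; cases v) (auto simp: D8_def tangent_def inner_prod_def)

text \<open>The j and k components of p^-1 i p, for unit p, are \<open>- 2 * hopf_im p\<close> and
  \<open>2 * hopf_re p\<close>. Replacing p by px conjugates this quaternion by x, and conjugation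
  by an element of \<open>D8\<close> only changes signs of components.\<close>

lemma hopf_quotient_qmult:
  assumes "x \<in> D8"
  shows "hopf_im (qmult p x) = 0 \<longleftrightarrow> hopf_im p = 0"
    and "hopf_re (qmult p x) / hopf_im (qmult p x) = hopf_re p / hopf_im p \<or>
         hopf_re (qmult p x) / hopf_im (qmult p x) = - (hopf_re p / hopf_im p)"
proof -
  have "(hopf_im (qmult p x) = hopf_im p \<or> hopf_im (qmult p x) = - hopf_im p) \<and>
      (hopf_re (qmult p x) = hopf_re p \<or> hopf_re (qmult p x) = - hopf_re p)"
    using assms by (cases p) (auto simp: D8_def)
  then show "hopf_im (qmult p x) = 0 \<longleftrightarrow> hopf_im p = 0"
    "hopf_re (qmult p x) / hopf_im (qmult p x) = hopf_re p / hopf_im p \<or>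
       hopf_re (qmult p x) / hopf_im (qmult p x) = - (hopf_re p / hopf_im p)"
    by auto
qed

text \<open>Where \<open>hopf_im\<close> is nonzero, the sign of the quotient passes through the odd
  arctangent and is absorbed by the even \<open>\<Phi>\<close>. Both sides are continuous, so the
  equality extends to the zeros of \<open>hopf_im\<close>.\<close>

lemma D8_invariant_function:
  assumes "D8_domain U" "smooth_function_on U f" "\<And>t. \<Phi> (- t) = \<Phi> t" "has_arctan_form U \<Phi> f"
    and "x \<in> D8" "p \<in> U"
  shows "f (qmult p x) = f p"
proof -
  have U: "openin (top_of_set SU2) U" and inv: "\<And>q. q \<in> U \<Longrightarrow> qmult q x \<in> U"
    using assms(1,5) by (auto simp: D8_domain_def D8_invariant_def)
  have f: "continuous_on U f" using U assms(2) by (rule smooth_function_on_continuous)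
  have "continuous_on U (\<lambda>q. qmult q x)"
    by (rule has_derivative_continuous_on) (rule qmult_has_derivative)
  then have "continuous_on U (\<lambda>q. f (qmult q x))"
    by (rule continuous_on_compose2[OF f]) (use inv in blast)
  then have "continuous_on U (\<lambda>q. f (qmult q x) - f q)"
    using f by (rule continuous_on_diff)
  moreover have "f (qmult q x) - f q = 0" if "q \<in> U" "hopf_im q \<noteq> 0" for q
    using has_arctan_formD[OF assms(4) that] has_arctan_formD[OF assms(4) inv[OF that(1)]]
      hopf_quotient_qmult[OF assms(5), of q] that(2) assms(3)
    by (auto simp: arctan_minus)
  ultimately have "f (qmult p x) - f p = 0"
    using eq_zero_if_zero_off_hopf_im[OF U] assms(6) by blast
  then show ?thesis by simp
qed

text \<open>The chain rule for f(qx) = f(q), with the ambient extension taken around the image point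
  \<open>qmult p x\<close>. Right multiplication by \<open>x\<close> maps \<open>SU2\<close> into
  itself, so derivatives within \<open>SU2\<close> compose.\<close>

lemma differential_right_invariant:
  assumes "openin (top_of_set SU2) U" "smooth_function_on U f" "x \<in> D8"
    and "\<And>q. q \<in> U \<Longrightarrow> qmult q x \<in> U" "\<And>q. q \<in> U \<Longrightarrow> f (qmult q x) = f q"
    and "p \<in> U" "v \<in> tangent p"
  shows "differential f (qmult p x) (qmult v x) = differential f p v"
proof -
  obtain T where T: "open T" "U = SU2 \<inter> T" using assms(1) by (auto simp: openin_open)
  obtain V F where ext: "smooth_extension V F f" and px: "qmult p x \<in> V"
    by (rule smooth_function_on_extension[OF assms(1,2) assms(4)[OF assms(6)]]) blast
  interpret smooth_extension V F f by (rule ext)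
  define D where "D = frechet_derivative F (at (qmult p x))"
  have SU2: "p \<in> SU2" "qmult p x \<in> SU2" using T assms(4,6) by auto
  have "qmult q x \<in> SU2" if "q \<in> SU2" for q
    using that assms(3) D8_domain_SU2 by (simp add: D8_domain_def D8_invariant_def)
  then have "(f has_derivative D) (at (qmult p x) within (\<lambda>q. qmult q x) ` SU2)"
    unfolding D_def
    by (intro has_derivative_subset[OF has_derivative_within_SU2[OF px SU2(2)]]) auto
  then have "((\<lambda>q. f (qmult q x)) has_derivative (\<lambda>v. D (qmult v x))) (at p within SU2)"
    by (rule has_derivative_in_compose[OF qmult_has_derivative])
  moreover have "\<forall>\<^sub>F q in at p within SU2. f (qmult q x) = f q"
    using T assms(5,6) unfolding eventually_at_topological by blast
  ultimately have "(f has_derivative (\<lambda>v. D (qmult v x))) (at p within SU2)"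
    using assms(5)[OF assms(6)] SU2(1) by (rule has_derivative_transform_eventually)
  then have "differential f p v = D (qmult v x)"
    unfolding differential_def using SU2(1) assms(7) by (rule frechet_derivative_within_SU2)
  then show ?thesis
    using differential_eq[OF px SU2(2) qmult_tangent[OF assms(3,7)]] by (simp add: D_def)
qed

section \<open>Vanishing of the derivative along the Hopf fibres\<close>

text \<open>The circle is the orbit of \<open>p\<close> under left multiplication by cos t + i sin
  t, which scales both quadratic forms by the squared norm of that factor.\<close>

lemma hopf_great_circle:
  "hopf_re (cos t *\<^sub>R p + sin t *\<^sub>R qmult (0, 1, 0, 0) p) = hopf_re p"
  "hopf_im (cos t *\<^sub>R p + sin t *\<^sub>R qmult (0, 1, 0, 0) p) = hopf_im p"
proof -
  have "hopf_re (C *\<^sub>R p + S *\<^sub>R qmult (0, 1, 0, 0) p) = (C * C + S * S) * hopf_re p"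
    "hopf_im (C *\<^sub>R p + S *\<^sub>R qmult (0, 1, 0, 0) p) = (C * C + S * S) * hopf_im p" for C S
    by (cases p; simp add: algebra_simps)+
  then show "hopf_re (cos t *\<^sub>R p + sin t *\<^sub>R qmult (0, 1, 0, 0) p) = hopf_re p"
    "hopf_im (cos t *\<^sub>R p + sin t *\<^sub>R qmult (0, 1, 0, 0) p) = hopf_im p"
    by simp_all
qed

text \<open>The function \<open>f\<close> is constant along the fibre through a point with
  \<open>hopf_im\<close> nonzero, and the fibre has velocity ip there. The remaining points follow
  by continuity, with \<open>V \<inter> SU2\<close> as the relatively open set.\<close>

lemma (in smooth_extension) derivative_along_Hopf_fibre:
  assumes "openin (top_of_set SU2) U" "has_arctan_form U \<Phi> f" "V \<inter> SU2 \<subseteq> U" "p \<in> V" "p \<in> SU2"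
  shows "frechet_derivative F (at p) (qmult (0, 1, 0, 0) p) = 0"
proof -
  have "frechet_derivative F (at q) (qmult (0, 1, 0, 0) q) = 0"
    if q: "q \<in> V \<inter> SU2" and im: "hopf_im q \<noteq> 0" for q
  proof -
    define v where "v = qmult (0, 1, 0, 0) q"
    define c where "c t = cos t *\<^sub>R q + sin t *\<^sub>R v" for t
    define D where "D = frechet_derivative F (at q)"
    have v: "v \<in> SU2" "v \<in> tangent q"
      using q frame_in_SU2 frame_tangent by (auto simp: v_def)
    have c: "c t \<in> SU2" "hopf_re (c t) = hopf_re q" "hopf_im (c t) = hopf_im q" for t
      using q v great_circle_in_SU2 hopf_great_circle by (auto simp: c_def v_def)
    have c0: "c 0 = q" by (simp add: c_def)
    have "f (c t) = f q" if "c t \<in> U" for t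
      using has_arctan_formD[OF assms(2) that] has_arctan_formD[OF assms(2), of q] q im c assms(3)
      by auto
    moreover have "\<forall>\<^sub>F t in nhds 0. c t \<in> U"
      unfolding c_def using q v assms(3) by (intro eventually_great_circle_in[OF assms(1)]) auto
    ultimately have "\<forall>\<^sub>F t in at 0. f q = f (c t)"
      by (auto simp: eventually_nhds_conv_at elim!: eventually_mono)
    then have const: "((\<lambda>t. f (c t)) has_derivative (\<lambda>t. 0)) (at 0)"
      using c0 by (intro has_derivative_transform_eventually[OF has_derivative_const]) auto
    have dc: "(c has_derivative (\<lambda>t. t *\<^sub>R v)) (at 0)"
      unfolding c_def by (auto intro!: derivative_eq_intros)
    have df: "(f has_derivative D) (at (c 0) within range c)"
      unfolding c0 D_def using q c(1)
      by (intro has_derivative_subset[OF has_derivative_within_SU2[of q]]) auto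
    have "(\<lambda>t. D (t *\<^sub>R v)) = (\<lambda>t. 0)"
      by (rule has_derivative_unique[OF has_derivative_in_compose[OF dc df] const])
    from fun_cong[OF this, of 1] show ?thesis by (simp add: D_def v_def)
  qed
  moreover have "continuous_on (V \<inter> SU2) (\<lambda>q. frechet_derivative F (at q) (qmult (0, 1, 0, 0) q))"
  proof (intro continuous_at_imp_continuous_on ballI)
    fix q assume "q \<in> V \<inter> SU2"
    moreover have "linear (qmult (0, 1, 0, 0))"
      by (auto intro!: linearI)
    ultimately show "isCont (\<lambda>q. frechet_derivative F (at q) (qmult (0, 1, 0, 0) q)) q"
      by (intro differentiable_imp_continuous_within frechet_derivative_along_differentiable)
        (auto simp: linear_conv_bounded_linear)
  qed
  moreover have "openin (top_of_set SU2) (V \<inter> SU2)"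
    using V by (simp add: Int_commute openin_open_Int)
  ultimately show ?thesis
    using eq_zero_if_zero_off_hopf_im[of "V \<inter> SU2"] assms(4,5) by blast
qed

section \<open>The structure equations and the descent of the coframing\<close>

lemma linear_alpha: "linear (\<alpha>1 q)" "linear (\<alpha>2 q)" "linear (\<alpha>3 q)"
  by (cases q; auto intro!: linearI simp: algebra_simps)+

theorem proposition6p5:
  fixes U :: "quat set" and f :: "quat \<Rightarrow> real" and \<Phi> :: "real \<Rightarrow> real"
    and \<omega>1 \<omega>2 \<omega>3 :: one_form
  assumes "D8_domain U"
    and "smooth_function_on U f"
    and "\<And>t. \<Phi> (- t) = \<Phi> t"
    and "has_arctan_form U \<Phi> f"
    and "\<omega>1 = \<alpha>1"
    and "\<omega>2 = (\<lambda>p v. differential f p v - \<alpha>3 p v)"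
    and "\<omega>3 = \<alpha>2"
  shows "IJ1_generalized_Finsler U (d_\<alpha>1 f) (d_\<alpha>2 f) \<omega>1 \<omega>2 \<omega>3 \<and>
    descends_D8 U \<omega>1 \<and> descends_D8 U \<omega>2 \<and> descends_D8 U \<omega>3"
proof -
  have U: "openin (top_of_set SU2) U" and inv: "D8_invariant U"
    using assms(1) by (auto simp: D8_domain_def)
  have SU2: "p \<in> SU2" if "p \<in> U" for p using U that openin_imp_subset by blast
  \<comment> \<open>There is no \<alpha>3 term, since the derivative along the Hopf fibre
    vanishes.\<close>
  have df: "differential f p v = d_\<alpha>1 f p * \<alpha>1 p v + d_\<alpha>2 f p * \<alpha>2 p v"
    if p: "p \<in> U" and v: "v \<in> tangent p" for p v
  proof -
    obtain V F where ext: "smooth_extension V F f" and pV: "p \<in> V" "V \<inter> SU2 \<subseteq> U"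
      by (rule smooth_function_on_extension[OF U assms(2) p]) blast
    interpret smooth_extension V F f by (rule ext)
    show ?thesis
      using differential_directional_derivs[OF SU2[OF p] Ck_on_frechet_derivative(3)[OF F pV(1)]
          differential_eq[OF pV(1) SU2[OF p]]
          derivative_along_Hopf_fibre[OF U assms(4) pV(2,1) SU2[OF p]] v] .
  qed
  have d\<omega>2: "ext_deriv \<omega>2 p v w = - ext_deriv \<alpha>3 p v w"
    if p: "p \<in> U" and vw: "v \<in> tangent p" "w \<in> tangent p" for p v w
  proof -
    obtain V F where ext: "smooth_extension V F f" and "p \<in> V"
      by (rule smooth_function_on_extension[OF U assms(2) p]) blast
    then show ?thesis
      unfolding assms(6) using SU2[OF p] vw alpha_proj(3) alpha_linear(3)
      by (rule smooth_extension.ext_deriv_differential_diff)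
  qed
  have "smooth_one_form_on U \<omega>1" "smooth_one_form_on U \<omega>3"
    unfolding assms(5,7) by (intro smooth_one_form_on_bilinear linear_alpha alpha_linear)+
  moreover have "smooth_one_form_on U \<omega>2"
    unfolding assms(6)
    using U assms(2) linear_alpha(3) alpha_linear(3) by (rule smooth_one_form_on_differential_diff)
  moreover have "c1 = 0 \<and> c2 = 0 \<and> c3 = 0"
    if "p \<in> U" and c: "\<forall>v\<in>tangent p. c1 * \<omega>1 p v + c2 * \<omega>2 p v + c3 * \<omega>3 p v = 0" for p c1 c2 c3
  proof -
    \<comment> \<open>On ip only \<omega>2 is nonzero, with value -2, so c2 = 0; then jp and kp
      isolate c1 and c3.\<close>
    note c' = c[rule_format, OF frame_tangent, unfolded assms(5-7) df[OF \<open>p \<in> U\<close> frame_tangent]]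
    show ?thesis
      using c'[of "(1, 0, 0)"] c'[of "(0, 1, 0)"] c'[of "(0, 0, 1)"]
      by (auto simp: alpha_frame[OF SU2[OF \<open>p \<in> U\<close>]])
  qed
  ultimately have "coframe_on U \<omega>1 \<omega>2 \<omega>3" unfolding coframe_on_def by blast
  then have "IJ1_generalized_Finsler U (d_\<alpha>1 f) (d_\<alpha>2 f) \<omega>1 \<omega>2 \<omega>3"
    unfolding IJ1_generalized_Finsler_def
  proof (intro conjI ballI)
    fix p v w assume p: "p \<in> U" and v: "v \<in> tangent p" and w: "w \<in> tangent p"
    note \<alpha> = alpha_structure_equations[OF SU2[OF p] v w]
    \<comment> \<open>With df = I \<alpha>1 + J \<alpha>2, the I terms cancel and the J term drops
      out of \<omega>2 \<and> \<omega>3, leaving - \<alpha>3 \<and> \<alpha>2, which is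
      d\<alpha>1.\<close>
    show "ext_deriv \<omega>1 p v w = - d_\<alpha>1 f p * wedge \<omega>1 \<omega>3 p v w + wedge \<omega>2 \<omega>3 p v w"
      unfolding assms(5-7) \<alpha> by (simp add: wedge_def df p v w algebra_simps)
    show "ext_deriv \<omega>2 p v w = - wedge \<omega>1 \<omega>3 p v w"
      using d\<omega>2[OF p v w] by (simp add: assms(5,7) \<alpha>)
    \<comment> \<open>Here the J terms cancel and the I term drops out, leaving - \<alpha>1 \<and>
      \<alpha>3, which is d\<alpha>2.\<close>
    show "ext_deriv \<omega>3 p v w = wedge \<omega>1 \<omega>2 p v w - d_\<alpha>2 f p * wedge \<omega>1 \<omega>3 p v w"
      unfolding assms(5-7) \<alpha> by (simp add: wedge_def df p v w algebra_simps)
  qed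
  moreover have "descends_D8 U \<omega>1" "descends_D8 U \<omega>3"
    using inv by (simp_all add: descends_D8_def pullback_qmult alpha_right_invariant assms(5,7))
  moreover have "descends_D8 U \<omega>2"
    unfolding descends_D8_def
  proof (intro conjI ballI)
    fix x p v assume x: "x \<in> D8" and p: "p \<in> U" and v: "v \<in> tangent p"
    have "differential f (qmult p x) (qmult v x) = differential f p v"
      using inv x D8_invariant_function[OF assms(1-4) x]
      by (intro differential_right_invariant[OF U assms(2) x _ _ p v]) (auto simp: D8_invariant_def)
    then show "pullback (\<lambda>g. qmult g x) \<omega>2 p v = \<omega>2 p v"
      by (simp add: pullback_qmult alpha_right_invariant x assms(6))
  qed (rule inv)
  ultimately show ?thesis by blast
qed

end
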